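(* Let $H$ be a monoid such that for every $a\in H$ there exist $b\in H$ and $c\in\mathcal{S}(H)$ with $a=b^2c$. Let $M$ be a submonoid of $H$ such that for every $a\in H$ and $b\in\mathcal{S}(H)$, $$a^2b\in M\Rightarrow a\in M \text{ and } ab\in M.$$ Then $\mathcal{A}(M)\subset\mathcal{S}(H)$.
   Context: Monoid means commutative cancellative monoid (written multiplicatively). $H^{\times}$ denotes the group of invertible elements of $H$. An element $a\in H$ is square-free if it cannot be written as $a=b^2c$ with $b,c\in H$ and $b\notin H^{\times}$; $\mathcal{S}(H)$ is the set of square-free elements of $H$. $\mathcal{A}(M)$ is the set of atoms of the monoid $M$, i.e. elements of $M$ not invertible in $M$ that are not a product of two elements of $M$ both non-invertible in $M$. *)

theory Defs
  imports "HOL-Algebra.Divisibility"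
begin

definition square_free_elements :: "('a, 'b) monoid_scheme \<Rightarrow> 'a set"
  where "square_free_elements G =
    {a \<in> carrier G. \<not> (\<exists>b \<in> carrier G. \<exists>c \<in> carrier G.
        b \<notin> Units G \<and> a = b [^]\<^bsub>G\<^esub> (2::nat) \<otimes>\<^bsub>G\<^esub> c)}"

definition atoms :: "('a, 'b) monoid_scheme \<Rightarrow> 'a set"
  where "atoms G =
    {a \<in> carrier G. a \<notin> Units G \<and>
      \<not> (\<exists>b \<in> carrier G. \<exists>c \<in> carrier G.
        b \<notin> Units G \<and> c \<notin> Units G \<and> a = b \<otimes>\<^bsub>G\<^esub> c)}"

text \<open>In a cancellative commutative monoid, \<^const>\<open>atoms\<close> agrees with the library's
  \<^const>\<open>irreducible\<close>, which is phrased via proper divisors.\<close>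

lemma (in comm_monoid_cancel) atoms_eq_irreducible:
  "atoms G = {a \<in> carrier G. irreducible G a}"
proof (intro equalityI subsetI)
  fix a assume a: "a \<in> atoms G"
  have "b \<in> Units G" if b: "b \<in> carrier G" "properfactor G b a" for b
  proof (rule ccontr)
    assume "b \<notin> Units G"
    obtain c where c: "c \<in> carrier G" "a = b \<otimes> c"
      using b(2) by (auto simp: properfactor_def factor_def)
    with a b(1) \<open>b \<notin> Units G\<close> have "c \<in> Units G"
      by (auto simp: atoms_def)
    with b(1) c have "b = a \<otimes> inv c"
      by (simp add: m_assoc)
    with \<open>c \<in> Units G\<close> have "a divides b"
      by (auto simp: factor_def)
    with b(2) show False by (simp add: properfactor_def)
  qed
  with a show "a \<in> {a \<in> carrier G. irreducible G a}"
    by (auto simp: atoms_def irreducible_def)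
next
  fix a assume a: "a \<in> {a \<in> carrier G. irreducible G a}"
  have False if bc: "b \<in> carrier G" "c \<in> carrier G" "b \<notin> Units G" "c \<notin> Units G" "a = b \<otimes> c" for b c
  proof -
    have "b divides a" using bc by (auto simp: factor_def)
    with a bc have "a divides b" by (auto simp: irreducible_def properfactor_def)
    then obtain d where d: "d \<in> carrier G" "b = b \<otimes> c \<otimes> d"
      using bc(5) by (auto simp: factor_def)
    then have "b \<otimes> (c \<otimes> d) = b \<otimes> \<one>" using bc by (simp add: m_assoc)
    then have "c \<otimes> d = \<one>" using l_cancel bc d by blast
    with bc d have "c \<in> Units G" by (auto simp: Units_def m_comm)
    with bc show False by simp
  qed
  with a show "a \<in> atoms G"
    by (auto simp: atoms_def irreducible_def)
qed

end

theory Submission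
  imports Defs
begin

text \<open>Write an atom \<open>a\<close> of \<open>M\<close> as \<open>b^2 c\<close> with
  \<open>c\<close> square-free in \<open>H\<close>. The closure hypothesis puts both
  \<open>b\<close> and \<open>bc\<close> in \<open>M\<close>, so \<open>a = b(bc)\<close> is a
  factorization inside \<open>M\<close>, and one factor must be invertible in \<open>M\<close>,
  hence in \<open>H\<close> (\<open>Units_submonoid_subset\<close>). Either way \<open>b\<close> is
  a unit of \<open>H\<close>, so \<open>a\<close> is a unit times \<open>c\<close> and inherits
  square-freeness (\<open>Units_mult_left_square_free\<close>).\<close>

text \<open>A unit can be moved into the cofactor: \<open>u c = d^2 e\<close> gives
  \<open>c = d^2 (u^-1 e)\<close>, with the same non-unit \<open>d\<close>.\<close>

lemma (in comm_monoid) Units_mult_left_square_free: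
  assumes u: "u \<in> Units G" and c: "c \<in> square_free_elements G"
  shows "u \<otimes> c \<in> square_free_elements G"
proof -
  have cc: "c \<in> carrier G" using c by (simp add: square_free_elements_def)
  have False if d: "d \<in> carrier G" "d \<notin> Units G" and e: "e \<in> carrier G"
    and eq: "u \<otimes> c = d [^] (2::nat) \<otimes> e" for d e
  proof -
    have "c = inv u \<otimes> (u \<otimes> c)"
      using u cc by (metis Units_closed Units_inv_closed Units_l_inv l_one m_assoc)
    also have "\<dots> = d [^] (2::nat) \<otimes> (inv u \<otimes> e)"
      using u d e by (simp add: eq m_lcomm)
    finally show False
      using c d e u by (auto simp: square_free_elements_def)
  qed
  then show ?thesis
    using u cc by (auto simp: square_free_elements_def)
qed

text \<open>An inverse found in \<open>M\<close> is also an inverse in \<open>H\<close>, as product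
  and identity are shared. The converse can fail: the inverse in \<open>H\<close> may lie outside
  \<open>M\<close>.\<close>

lemma (in monoid) Units_submonoid_subset:
  assumes "submonoid M G"
  shows "Units (G\<lparr>carrier := M\<rparr>) \<subseteq> Units G"
  using submonoid.subset[OF assms] by (auto simp: Units_def)

theorem proposition4p1:
  fixes H :: "('a, 'b) monoid_scheme" and M :: "'a set"
  assumes "comm_monoid_cancel H"
    and "\<And>a. a \<in> carrier H \<Longrightarrow>
      \<exists>b \<in> carrier H. \<exists>c \<in> square_free_elements H. a = b [^]\<^bsub>H\<^esub> (2::nat) \<otimes>\<^bsub>H\<^esub> c"
    and "submonoid M H"
    and "\<And>a b. a \<in> carrier H \<Longrightarrow> b \<in> square_free_elements H \<Longrightarrow>
      a [^]\<^bsub>H\<^esub> (2::nat) \<otimes>\<^bsub>H\<^esub> b \<in> M \<Longrightarrow> a \<in> M \<and> a \<otimes>\<^bsub>H\<^esub> b \<in> M"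
  shows "atoms (H\<lparr>carrier := M\<rparr>) \<subseteq> square_free_elements H"
proof
  interpret comm_monoid_cancel H by fact
  fix a assume a: "a \<in> atoms (H\<lparr>carrier := M\<rparr>)"
  then have aM: "a \<in> M" by (simp add: atoms_def)
  then have "a \<in> carrier H" using submonoid.subset[OF assms(3)] by blast
  then obtain b c where b: "b \<in> carrier H" and c: "c \<in> square_free_elements H"
    and a_eq: "a = b [^]\<^bsub>H\<^esub> (2::nat) \<otimes>\<^bsub>H\<^esub> c"
    using assms(2) by blast
  have cc: "c \<in> carrier H" using c by (simp add: square_free_elements_def)
  have M: "b \<in> M" "b \<otimes>\<^bsub>H\<^esub> c \<in> M"
    using assms(4)[OF b c] aM a_eq by auto
  \<comment> \<open>This grouping is chosen because both factors are known to lie in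
    \<open>M\<close>; \<open>c\<close> itself may not.\<close>
  have "a = b \<otimes>\<^bsub>H\<^esub> (b \<otimes>\<^bsub>H\<^esub> c)"
    using b cc by (simp add: a_eq numeral_2_eq_2 m_assoc)
  then have "b \<in> Units (H\<lparr>carrier := M\<rparr>) \<or> b \<otimes>\<^bsub>H\<^esub> c \<in> Units (H\<lparr>carrier := M\<rparr>)"
    using a M by (auto simp: atoms_def)
  then have "b \<in> Units H \<or> b \<otimes>\<^bsub>H\<^esub> c \<in> Units H"
    using Units_submonoid_subset[OF assms(3)] by blast
  \<comment> \<open>If \<open>bc\<close> is the unit, then \<open>b\<close> divides a unit of
    \<open>H\<close> and so is one.\<close>
  then have "b \<in> Units H"
    using b cc unit_factor by blast
  then have "b [^]\<^bsub>H\<^esub> (2::nat) \<in> Units H"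
    by (simp add: numeral_2_eq_2)
  then show "a \<in> square_free_elements H"
    unfolding a_eq using c by (rule Units_mult_left_square_free)
qed

end
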